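(* If $f : \mathbb{R} \to \mathbb{R}$ is a bell-shaped function, then the sequence $(f(k) : k \in \mathbb{Z})$ is bell-shaped.
   Context: A function $g : \mathbb{R} \to \mathbb{R}$ (respectively, a sequence $(g(k) : k \in \mathbb{Z})$) changes sign at least $n$ times if there are points $x_0 < x_1 < \dots < x_n$ of $\mathbb{R}$ (respectively, of $\mathbb{Z}$) with $g(x_{j-1}) g(x_j) < 0$ for $j = 1, \dots, n$; it changes sign exactly $n$ times if it changes sign at least $n$ times but not at least $n+1$ times. Bell-shaped function: a nonnegative smooth (infinitely differentiable) function $f : \mathbb{R} \to \mathbb{R}$ which converges to zero at $\pm\infty$ and such that for every $n = 0, 1, 2, \ldots$ the $n$th derivative $f^{(n)}$ changes sign exactly $n$ times. Bell-shaped sequence: a nonnegative real sequence $(a(k) : k \in \mathbb{Z})$ which converges to zero as $k \to \pm\infty$ and such that for every $n = 0, 1, 2, \ldots$ the sequence $\Delta^n a(k)$ changes sign exactly $n$ times, where $\Delta a(k) = a(k+1) - a(k)$ and $\Delta^n$ is the $n$th iterate of $\Delta$. *)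

theory Defs
  imports "HOL-Analysis.Analysis"
begin

text \<open>
  Sign changes are defined once, for real-valued functions on a linear order; the orders used are
  the reals and the integers.
\<close>

definition changes_sign_at_least :: "('a::linorder \<Rightarrow> real) \<Rightarrow> nat \<Rightarrow> bool" where
  "changes_sign_at_least g n \<longleftrightarrow>
     (\<exists>x :: nat \<Rightarrow> 'a. strict_mono_on {0..n} x \<and> (\<forall>j\<in>{1..n}. g (x (j - 1)) * g (x j) < 0))"

definition changes_sign_exactly :: "('a::linorder \<Rightarrow> real) \<Rightarrow> nat \<Rightarrow> bool" where
  "changes_sign_exactly g n \<longleftrightarrow>
     changes_sign_at_least g n \<and> \<not> changes_sign_at_least g (n + 1)"

definition smooth :: "(real \<Rightarrow> real) \<Rightarrow> bool" where
  "smooth f \<longleftrightarrow> (\<forall>n x. (deriv ^^ n) f differentiable (at x))"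

definition bell_shaped_function :: "(real \<Rightarrow> real) \<Rightarrow> bool" where
  "bell_shaped_function f \<longleftrightarrow>
     (\<forall>x. f x \<ge> 0) \<and> smooth f \<and>
     (f \<longlongrightarrow> 0) at_bot \<and> (f \<longlongrightarrow> 0) at_top \<and>
     (\<forall>n. changes_sign_exactly ((deriv ^^ n) f) n)"

definition forward_difference :: "(int \<Rightarrow> real) \<Rightarrow> int \<Rightarrow> real" where
  "forward_difference a k = a (k + 1) - a k"

definition bell_shaped_sequence :: "(int \<Rightarrow> real) \<Rightarrow> bool" where
  "bell_shaped_sequence a \<longleftrightarrow>
     (\<forall>k. a k \<ge> 0) \<and>
     (a \<longlongrightarrow> 0) at_bot \<and> (a \<longlongrightarrow> 0) at_top \<and>
     (\<forall>n. changes_sign_exactly ((forward_difference ^^ n) a) n)"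

end

(*
The n-th difference at step h/2 determines the one at step h by n-fold averaging of neighbours, which
creates no sign changes and keeps the size of n-th difference quotients. Letting h tend to 0, every
sign alternation of the n-th differences of f on the integers is inherited by the n-th derivative.

Conversely a nonzero null sequence gains a sign change with every difference, by a discrete Rolle
argument. It remains to exclude that f vanishes at all integers. Then f would live on one unit
interval, and there is no compactly supported bell-shaped function (Hirschman): if z_1, ..., z_n
are the sign changes of f^(n) and p(x) = (x - z_1) ... (x - z_n), then p f^(n) has constant sign,
hence |int (x - c)^2 p f^(n)| <= R^2 |int p f^(n)| with c the barycentre of f and R the length of the
interval. Integrating by parts n times gives (n + 1) int (x - c)^2 f <= R^2 int f for all n, so f = 0.
*)
theory Submission
  imports Defs
begin

section \<open>Alternating lists\<close>

text \<open>Lists replace indexed points so that points can be put in front and moved by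
  \<open>map\<close>. Lists with at most one entry alternate vacuously, even at a zero of
  \<open>g\<close>.\<close>

definition alternating :: "('a::linorder \<Rightarrow> real) \<Rightarrow> 'a list \<Rightarrow> bool" where
  "alternating g = successively (\<lambda>x y. x < y \<and> g x * g y < 0)"

lemma alternating_Nil [simp]: "alternating g []"
  by (simp add: alternating_def)

lemma alternating_single [simp]: "alternating g [x]"
  by (simp add: alternating_def)

lemma alternating_Cons_Cons [simp]:
  "alternating g (x # y # xs) \<longleftrightarrow> x < y \<and> g x * g y < 0 \<and> alternating g (y # xs)"
  by (simp add: alternating_def conj_assoc)

lemma alternating_ConsD: "alternating g (x # xs) \<Longrightarrow> alternating g xs"
  by (cases xs) auto

lemma alternating_hd_less:
  "alternating g (x # xs) \<Longrightarrow> y \<in> set xs \<Longrightarrow> x < y"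
  by (induction xs arbitrary: x) force+

text \<open>In a list of at least two entries each entry has a neighbour, and their product is
  negative.\<close>

lemma alternating_nonzero:
  assumes "alternating g xs" "length xs \<ge> 2" "x \<in> set xs"
  shows "g x \<noteq> 0"
proof -
  obtain i where i: "i < length xs" "x = xs ! i"
    using assms(3) by (metis in_set_conv_nth)
  show ?thesis
  proof (cases "Suc i < length xs")
    case True
    then show ?thesis
      using successively_nth[OF assms(1)[unfolded alternating_def], of i] i by auto
  next
    case False
    then obtain j where "i = Suc j" using i assms(2) by (cases i) auto
    then show ?thesis
      using successively_nth[OF assms(1)[unfolded alternating_def], of j] i by auto
  qed
qed

lemma changes_sign_at_least_iff:
  "changes_sign_at_least g n \<longleftrightarrow> (\<exists>xs. length xs = Suc n \<and> alternating g xs)"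
proof
  assume "changes_sign_at_least g n"
  then obtain x :: "nat \<Rightarrow> 'a" where x: "strict_mono_on {0..n} x"
    and alt: "\<forall>j\<in>{1..n}. g (x (j - 1)) * g (x j) < 0"
    unfolding changes_sign_at_least_def by blast
  have "x i < x (Suc i) \<and> g (x i) * g (x (Suc i)) < 0" if "Suc i \<le> n" for i
    using that alt[rule_format, of "Suc i"] strict_mono_onD[OF x, of i "Suc i"] by auto
  then have "alternating g (map x [0..<Suc n])"
    unfolding alternating_def successively_conv_nth by (auto simp del: upt_Suc)
  then show "\<exists>xs. length xs = Suc n \<and> alternating g xs"
    by (intro exI[of _ "map x [0..<Suc n]"]) auto
next
  assume "\<exists>xs. length xs = Suc n \<and> alternating g xs"
  then obtain xs where len: "length xs = Suc n" and alt: "alternating g xs" by blast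
  have "successively (<) xs"
    using alt unfolding alternating_def by (rule successively_mono) auto
  then have "sorted_wrt (<) xs"
    by (subst (asm) successively_conv_sorted_wrt) (auto intro: transpI)
  then have "strict_mono_on {0..n} (\<lambda>i. xs ! i)"
    using len by (auto simp: strict_mono_on_def sorted_wrt_iff_nth_less)
  moreover have "g (xs ! (j - 1)) * g (xs ! j) < 0" if "j \<in> {1..n}" for j
    using that alt len successively_nth[of _ xs "j - 1"] unfolding alternating_def by fastforce
  ultimately show "changes_sign_at_least g n"
    unfolding changes_sign_at_least_def by blast
qed

section \<open>Differences and derivatives\<close>

text \<open>Twice the average of neighbours, that is \<open>E + 1\<close> with \<open>E\<close> the
  shift.\<close>

definition pair_sum :: "(int \<Rightarrow> real) \<Rightarrow> int \<Rightarrow> real" where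
  "pair_sum c k = c k + c (k + 1)"

text \<open>The larger of two summands in absolute value has the sign of the sum and at least half
  its size, so each point can be moved to it. The bound \<open>d\<close> and the window are tracked
  for the later limit.\<close>

lemma alternating_pair_sum:
  assumes alt: "alternating (pair_sum c) xs"
    and d: "\<forall>k\<in>set xs. d \<le> \<bar>pair_sum c k\<bar>" and sub: "set xs \<subseteq> {l..h}"
  shows "\<exists>ys. length ys = length xs \<and> alternating c ys \<and>
    (\<forall>k\<in>set ys. d / 2 \<le> \<bar>c k\<bar>) \<and> set ys \<subseteq> {l..h + 1}"
proof -
  define p where "p k = (if \<bar>c (k + 1)\<bar> \<le> \<bar>c k\<bar> then k else k + 1)" for k
  have p: "k \<le> p k" "p k \<le> k + 1" for k by (auto simp: p_def)
  have big: "\<bar>pair_sum c k\<bar> / 2 \<le> \<bar>c (p k)\<bar>" for k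
    by (auto simp: p_def pair_sum_def)
  have sgn: "(0 < pair_sum c k \<longrightarrow> 0 < c (p k)) \<and> (pair_sum c k < 0 \<longrightarrow> c (p k) < 0)" for k
    by (auto simp: p_def pair_sum_def)
  have "alternating c (map p xs)"
    unfolding alternating_def successively_map
  proof (rule successively_mono[OF alt[unfolded alternating_def]])
    fix x y assume xy: "x < y \<and> pair_sum c x * pair_sum c y < 0"
    then have neg: "c (p x) * c (p y) < 0"
      using sgn[of x] sgn[of y] by (auto simp: mult_less_0_iff)
    \<comment> \<open>In any case \<open>p x \<le> x + 1 \<le> y \<le> p y\<close>, so distinctness
      gives strict order.\<close>
    then have "p x \<noteq> p y" by (auto simp: mult_less_0_iff)
    then show "p x < p y \<and> c (p x) * c (p y) < 0"
      using xy neg p[of x] p[of y] by linarith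
  qed
  moreover have "d / 2 \<le> \<bar>c k\<bar>" if k: "k \<in> set (map p xs)" for k
  proof -
    obtain x where "x \<in> set xs" "k = p x" using k unfolding set_map by blast
    then show ?thesis using d big[of x] by fastforce
  qed
  moreover have "set (map p xs) \<subseteq> {l..h + 1}"
  proof -
    have "l \<le> p x \<and> p x \<le> h + 1" if "x \<in> set xs" for x
      using sub p[of x] that by fastforce
    then show ?thesis by auto
  qed
  ultimately show ?thesis by (intro exI[of _ "map p xs"]) auto
qed

lemma alternating_pair_sum_funpow:
  assumes "alternating ((pair_sum ^^ n) c) xs"
    and "\<forall>k\<in>set xs. d \<le> \<bar>(pair_sum ^^ n) c k\<bar>" and "set xs \<subseteq> {l..h}"
  shows "\<exists>ys. length ys = length xs \<and> alternating c ys \<and>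
    (\<forall>k\<in>set ys. d / 2 ^ n \<le> \<bar>c k\<bar>) \<and> set ys \<subseteq> {l..h + int n}"
  using assms
proof (induction n arbitrary: xs d h)
  case 0
  then show ?case by auto
next
  case (Suc n)
  obtain ys where ys: "length ys = length xs" "alternating ((pair_sum ^^ n) c) ys"
    "\<forall>k\<in>set ys. d / 2 \<le> \<bar>(pair_sum ^^ n) c k\<bar>" "set ys \<subseteq> {l..h + 1}"
    using alternating_pair_sum[of "(pair_sum ^^ n) c" xs d l h] Suc.prems by auto
  then show ?case using Suc.IH[of ys "d / 2" "h + 1"] by (auto simp: algebra_simps)
qed

lemma forward_difference_funpow_pair_sum:
  "(forward_difference ^^ n) (pair_sum c) = pair_sum ((forward_difference ^^ n) c)"
  by (induction n) (auto simp: forward_difference_def pair_sum_def fun_eq_iff)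

text \<open>With \<open>E\<close> the shift, this is the factorisation \<open>(E\<^sup>2 - 1)^n = (E + 1)^n (E - 1)^n\<close>.\<close>

lemma forward_difference_funpow_even:
  "(forward_difference ^^ n) (\<lambda>k. c (2 * k)) =
   (\<lambda>k. (pair_sum ^^ n) ((forward_difference ^^ n) c) (2 * k))"
proof (induction n arbitrary: c)
  case 0
  then show ?case by simp
next
  case (Suc n)
  have "forward_difference (\<lambda>k. c (2 * k)) = (\<lambda>k. pair_sum (forward_difference c) (2 * k))"
    by (simp add: forward_difference_def pair_sum_def fun_eq_iff algebra_simps)
  then show ?case
    by (simp add: funpow_Suc_right forward_difference_funpow_pair_sum Suc.IH del: funpow.simps)
qed

text \<open>With step \<open>h = 1 / 2 ^ m\<close>, the factor \<open>(1 / 2 ^ m) ^ n\<close> is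
  \<open>h ^ n\<close>, so the bound says that difference quotients stay at least \<open>d\<close>
  in size. The window says that all nodes \<open>k, ..., k + n\<close> of a difference stay, after
  scaling, between \<open>l\<close> and \<open>h + n\<close> in the notation of the
  statement.\<close>

lemma alternating_refine_grid:
  fixes f :: "real \<Rightarrow> real"
  assumes alt: "alternating ((forward_difference ^^ n) (\<lambda>k. f (of_int k))) xs"
    and d: "\<forall>k\<in>set xs. d \<le> \<bar>(forward_difference ^^ n) (\<lambda>k. f (of_int k)) k\<bar>"
    and sub: "set xs \<subseteq> {l..h}"
  shows "\<exists>ys. length ys = length xs \<and>
    alternating ((forward_difference ^^ n) (\<lambda>k. f (of_int k / 2 ^ m))) ys \<and>
    (\<forall>k\<in>set ys. d * (1 / 2 ^ m) ^ n \<le> \<bar>(forward_difference ^^ n) (\<lambda>k. f (of_int k / 2 ^ m)) k\<bar>) \<and>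
    set ys \<subseteq> {2 ^ m * l..2 ^ m * (h + int n) - int n}"
proof (induction m)
  case 0
  then show ?case using assms by auto
next
  case (Suc m)
  let ?c = "\<lambda>m k. f (of_int k / 2 ^ m)"
  let ?D = "\<lambda>m. (forward_difference ^^ n) (?c m)"
  obtain ys where ys: "length ys = length xs" "alternating (?D m) ys"
    "\<forall>k\<in>set ys. d * (1 / 2 ^ m) ^ n \<le> \<bar>?D m k\<bar>" "set ys \<subseteq> {2 ^ m * l..2 ^ m * (h + int n) - int n}"
    using Suc by blast
  let ?P = "(pair_sum ^^ n) (?D (Suc m))"
  \<comment> \<open>The coarse grid is the set of even points of the fine one; the points of
    \<open>ys\<close> are therefore doubled before the \<open>n\<close> pair sums are
    undone.\<close>
  have eq: "?D m = (\<lambda>k. ?P (2 * k))"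
    using forward_difference_funpow_even[of n "?c (Suc m)"] by simp
  have alt': "alternating ?P (map ((*) 2) ys)"
    using ys(2) unfolding alternating_def successively_map eq by (rule successively_mono) auto
  have d': "\<forall>k\<in>set (map ((*) 2) ys). d * (1 / 2 ^ m) ^ n \<le> \<bar>?P k\<bar>"
    using ys(3) unfolding eq by auto
  have sub': "set (map ((*) 2) ys) \<subseteq> {2 ^ Suc m * l..2 * (2 ^ m * (h + int n) - int n)}"
    using ys(4) by (auto simp: subset_iff)
  obtain zs where zs: "length zs = length (map ((*) 2) ys)" "alternating (?D (Suc m)) zs"
    "\<forall>k\<in>set zs. d * (1 / 2 ^ m) ^ n / 2 ^ n \<le> \<bar>?D (Suc m) k\<bar>"
    "set zs \<subseteq> {2 ^ Suc m * l..2 * (2 ^ m * (h + int n) - int n) + int n}"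
    using alternating_pair_sum_funpow[OF alt' d' sub'] by blast
  have e1: "d * (1 / 2 ^ m) ^ n / 2 ^ n = d * (1 / 2 ^ Suc m) ^ n"
    by (simp add: power_mult_distrib power_divide)
  \<comment> \<open>Doubling turns the margin \<open>n\<close> into \<open>2 * n\<close>; the
    \<open>n\<close> moves to the right use up half of it.\<close>
  have e2: "2 * (2 ^ m * (h + int n) - int n) + int n = 2 ^ Suc m * (h + int n) - int n"
    by (simp add: algebra_simps)
  show ?case
    using zs(1,2) zs(3)[unfolded e1] zs(4)[unfolded e2] ys(1) by (intro exI[of _ zs]) simp
qed

section \<open>From differences to derivatives\<close>

text \<open>Apply the claim for \<open>n\<close> to the increment of \<open>F\<close> over one step,
  then the mean value theorem to \<open>F n\<close>. The whole sequence of derivatives is a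
  parameter because the induction replaces it by its increments.\<close>

lemma forward_difference_funpow_mean_value:
  fixes F :: "nat \<Rightarrow> real \<Rightarrow> real"
  assumes "\<And>j x. (F j has_real_derivative F (Suc j) x) (at x)" and h: "h > 0"
  shows "\<exists>\<xi>. x \<le> \<xi> \<and> \<xi> \<le> x + n * h \<and>
    (\<forall>k. of_int k * h = x \<longrightarrow>
      (forward_difference ^^ n) (\<lambda>k. F 0 (of_int k * h)) k = h ^ n * F n \<xi>)"
  using assms(1)
proof (induction n arbitrary: F)
  case 0
  then show ?case by (auto intro!: exI[of _ x])
next
  case (Suc n)
  let ?G = "\<lambda>j x. F j (x + h) - F j x"
  have "(?G j has_real_derivative ?G (Suc j) x) (at x)" for j x
    by (auto intro!: derivative_eq_intros DERIV_chain2[OF Suc.prems] Suc.prems)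
  from Suc.IH[of ?G, OF this] obtain \<xi> where \<xi>: "x \<le> \<xi>" "\<xi> \<le> x + n * h"
    "\<And>k. of_int k * h = x \<Longrightarrow>
      (forward_difference ^^ n) (\<lambda>k. ?G 0 (of_int k * h)) k = h ^ n * ?G n \<xi>" by blast
  obtain z where z: "\<xi> < z" "z < \<xi> + h" "F n (\<xi> + h) - F n \<xi> = (\<xi> + h - \<xi>) * F (Suc n) z"
    using MVT2[of \<xi> "\<xi> + h" "F n" "F (Suc n)"] Suc.prems h by auto
  have "forward_difference (\<lambda>k. F 0 (of_int k * h)) = (\<lambda>k. ?G 0 (of_int k * h))"
    by (simp add: forward_difference_def fun_eq_iff algebra_simps)
  then have "(forward_difference ^^ Suc n) (\<lambda>k. F 0 (of_int k * h)) k = h ^ Suc n * F (Suc n) z"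
    if "of_int k * h = x" for k
    using \<xi>(3)[OF that] z(3) by (simp add: funpow_Suc_right del: funpow.simps)
  then show ?case using \<xi> z by (intro exI[of _ z]) (auto simp: algebra_simps)
qed

text \<open>On a fine grid the differences are \<open>h ^ n\<close> times values of
  \<open>F n\<close> that are at least \<open>d\<close> in size. Uniform continuity carries their
  signs over to the grid points.\<close>

lemma changes_sign_at_least_derivative:
  fixes F :: "nat \<Rightarrow> real \<Rightarrow> real"
  assumes F: "\<And>j x. (F j has_real_derivative F (Suc j) x) (at x)"
    and "changes_sign_at_least ((forward_difference ^^ n) (\<lambda>k. F 0 (of_int k))) m" and "m > 0"
  shows "changes_sign_at_least (F n) m"
proof -
  let ?D = "(forward_difference ^^ n) (\<lambda>k. F 0 (of_int k))"
  obtain xs where xs: "length xs = Suc m" "alternating ?D xs"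
    using assms(2) unfolding changes_sign_at_least_iff by blast
  \<comment> \<open>Since \<open>m > 0\<close> there are at least two points; this makes the minimum
    \<open>d\<close> positive.\<close>
  have nz: "?D k \<noteq> 0" if "k \<in> set xs" for k
    using alternating_nonzero[OF xs(2)] xs(1) \<open>m > 0\<close> that by auto
  define d where "d = Min ((\<lambda>k. \<bar>?D k\<bar>) ` set xs)"
  have ne: "set xs \<noteq> {}" using xs by auto
  have d: "d > 0" "\<forall>k\<in>set xs. d \<le> \<bar>?D k\<bar>"
    unfolding d_def using ne nz by (auto simp: Min_gr_iff)
  define l where "l = Min (set xs)"
  define h where "h = Max (set xs)"
  have sub: "set xs \<subseteq> {l..h}" unfolding l_def h_def by auto
  let ?I = "{of_int l..of_int (h + int n) :: real}"
  have "continuous_on ?I (F n)"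
    using F by (meson DERIV_isCont continuous_at_imp_continuous_on)
  then have "uniformly_continuous_on ?I (F n)"
    by (rule compact_uniformly_continuous) auto
  then obtain e where e: "e > 0"
    "\<And>x y. x \<in> ?I \<Longrightarrow> y \<in> ?I \<Longrightarrow> dist y x < e \<Longrightarrow> dist (F n y) (F n x) < d"
    using d(1) unfolding uniformly_continuous_on_def by metis
  \<comment> \<open>The divisor \<open>n + 1\<close> is nonzero even for \<open>n = 0\<close>, and
    it makes \<open>n\<close> steps of the grid shorter than \<open>e\<close>.\<close>
  obtain N where N: "(1 / 2) ^ N < e / (n + 1)"
    using e(1) real_arch_pow_inv[of "e / (n + 1)" "1 / 2"] by auto
  let ?h = "1 / 2 ^ N :: real"
  let ?E = "(forward_difference ^^ n) (\<lambda>k. F 0 (of_int k * ?h))"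
  obtain ys where ys: "length ys = length xs" "alternating ?E ys"
    "\<forall>k\<in>set ys. d * ?h ^ n \<le> \<bar>?E k\<bar>" "set ys \<subseteq> {2 ^ N * l..2 ^ N * (h + int n) - int n}"
    using alternating_refine_grid[OF xs(2) d(2) sub, of N] by auto
  \<comment> \<open>Intermediate points \<open>\<xi>\<close> of different \<open>k\<close> need not
    come in order, whereas the grid points do; hence the sign is moved from \<open>\<xi>\<close> to
    \<open>of_int k * ?h\<close>.\<close>
  have sgn: "0 < F n (of_int k * ?h) * ?E k" if k: "k \<in> set ys" for k
  proof -
    let ?x = "of_int k * ?h"
    obtain \<xi> where \<xi>: "?x \<le> \<xi>" "\<xi> \<le> ?x + n * ?h" "?E k = ?h ^ n * F n \<xi>"
      using forward_difference_funpow_mean_value[of F ?h ?x n] F by auto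
    have "2 ^ N * l \<le> k" "k + int n \<le> 2 ^ N * (h + int n)" using ys(4) k by auto
    then have "real_of_int (2 ^ N * l) \<le> real_of_int k"
      "real_of_int (k + int n) \<le> real_of_int (2 ^ N * (h + int n))"
      by (simp_all only: of_int_le_iff)
    then have "of_int l \<le> ?x" "?x + n * ?h \<le> of_int (h + int n)"
      by (simp_all add: field_simps)
    then have I: "?x \<in> ?I" "\<xi> \<in> ?I" using \<xi> by auto
    have "n * ?h \<le> (n + 1) * ?h" by (simp add: field_simps)
    also have "\<dots> < e" using N by (simp add: field_simps power_divide)
    finally have "dist ?x \<xi> < e" using \<xi> by (simp add: dist_real_def)
    then have "\<bar>F n ?x - F n \<xi>\<bar> < d" using e(2)[OF I(2) I(1)] by (simp add: dist_real_def)
    moreover have "d \<le> \<bar>F n \<xi>\<bar>"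
      using ys(3) k \<xi>(3) by (auto simp: abs_mult)
    ultimately have "0 < F n ?x * F n \<xi>" by (auto simp: zero_less_mult_iff abs_if split: if_splits)
    then show ?thesis unfolding \<xi>(3) by (simp add: mult.left_commute)
  qed
  have "successively (\<lambda>x y. of_int x * ?h < of_int y * ?h \<and>
      F n (of_int x * ?h) * F n (of_int y * ?h) < 0) ys"
    using ys(2) unfolding alternating_def
  proof (rule successively_mono)
    fix x y assume "x \<in> set ys" "y \<in> set ys" and xy: "x < y \<and> ?E x * ?E y < 0"
    then have "0 < F n (of_int x * ?h) * ?E x" "0 < F n (of_int y * ?h) * ?E y" using sgn by auto
    then show "of_int x * ?h < of_int y * ?h \<and> F n (of_int x * ?h) * F n (of_int y * ?h) < 0"
      using xy by (auto simp: zero_less_mult_iff mult_less_0_iff divide_strict_right_mono)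
  qed
  then have "alternating (F n) (map (\<lambda>k. of_int k * ?h) ys)"
    unfolding alternating_def successively_map .
  then show ?thesis
    unfolding changes_sign_at_least_iff using ys(1) xs(1)
    by (intro exI[of _ "map (\<lambda>k. of_int k * ?h) ys"]) auto
qed

section \<open>Discrete Rolle theorem\<close>

text \<open>An increment is a sum of differences, so one of them shares its sign. The factor
  \<open>s\<close> treats rises and falls together.\<close>

lemma forward_difference_sign:
  assumes "u < v" "0 < (b v - b u) * s"
  shows "\<exists>y. u \<le> y \<and> y < v \<and> 0 < forward_difference b y * s"
proof (rule ccontr)
  assume "\<nexists>y. u \<le> y \<and> y < v \<and> 0 < forward_difference b y * s"
  then have neg: "(b (y + 1) - b y) * s \<le> 0" if "u \<le> y" "y < v" for y
    using that by (auto simp: forward_difference_def not_less)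
  have "w \<le> v \<longrightarrow> (b w - b u) * s \<le> 0" if "u \<le> w" for w
    using that
  proof (induction w rule: int_ge_induct)
    case (step w)
    then show ?case using neg[of w] by (auto simp: algebra_simps)
  qed auto
  from this[of v] show False using assms by auto
qed

text \<open>Far to the right \<open>b\<close> is smaller than \<open>b x\<close> in absolute value,
  so on balance it moves from \<open>b x\<close> towards zero.\<close>

lemma forward_difference_sign_at_top:
  assumes "(b \<longlongrightarrow> 0) at_top" "b x \<noteq> 0"
  shows "\<exists>y\<ge>x. forward_difference b y * b x < 0"
proof -
  have "\<forall>\<^sub>F w in at_top. dist (b w) 0 < \<bar>b x\<bar>"
    using assms by (intro tendstoD) auto
  then have "\<forall>\<^sub>F w in at_top. dist (b w) 0 < \<bar>b x\<bar> \<and> x < w"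
    using eventually_gt_at_top[of x] by (rule eventually_conj)
  then obtain w where w: "\<bar>b w\<bar> < \<bar>b x\<bar>" "x < w"
    by (auto dest!: eventually_happens)
  have "0 < (b w - b x) * - b x"
    using w by (auto simp: zero_less_mult_iff mult_less_0_iff abs_if split: if_splits)
  then show ?thesis using forward_difference_sign[OF w(2), of b "- b x"] by auto
qed

lemma forward_difference_sign_at_bot:
  assumes "(b \<longlongrightarrow> 0) at_bot" "b x \<noteq> 0"
  shows "\<exists>y<x. 0 < forward_difference b y * b x"
proof -
  have "\<forall>\<^sub>F w in at_bot. dist (b w) 0 < \<bar>b x\<bar>"
    using assms by (intro tendstoD) auto
  moreover have "\<forall>\<^sub>F w in at_bot. w < x"
    using eventually_le_at_bot[of "x - 1"] by (rule eventually_mono) auto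
  ultimately have "\<forall>\<^sub>F w in at_bot. dist (b w) 0 < \<bar>b x\<bar> \<and> w < x"
    by (rule eventually_conj)
  then obtain w where w: "\<bar>b w\<bar> < \<bar>b x\<bar>" "w < x"
    by (auto dest!: eventually_happens)
  have "0 < (b x - b w) * b x"
    using w by (auto simp: zero_less_mult_iff abs_if split: if_splits)
  then show ?thesis using forward_difference_sign[OF w(2), of b "b x"] by auto
qed

lemma mult_neg_transfer:
  fixes p q u v :: real
  assumes "0 < p * u" "v * u < 0"
  shows "p * v < 0"
  using assms by (auto simp: zero_less_mult_iff mult_less_0_iff)

text \<open>Built from the right end: on the way from \<open>x\<close> to the next point some
  difference has the sign of the value there, and after the last point some difference has the
  opposite sign to the last value. The position and sign of \<open>y\<close> are the invariant that
  lets a new point go in front.\<close>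

lemma alternating_forward_difference_right:
  assumes "alternating b (x # xs)" "\<forall>k\<in>set (x # xs). b k \<noteq> 0" "(b \<longlongrightarrow> 0) at_top"
  shows "\<exists>y ys. length ys = length xs \<and> alternating (forward_difference b) (y # ys) \<and>
    x \<le> y \<and> forward_difference b y * b x < 0"
  using assms
proof (induction xs arbitrary: x)
  case Nil
  then show ?case using forward_difference_sign_at_top[of b x] by auto
next
  case (Cons x' xs)
  then obtain y ys where y: "length ys = length xs" "alternating (forward_difference b) (y # ys)"
    "x' \<le> y" "forward_difference b y * b x' < 0"
    using Cons.IH[of x'] by auto blast
  have neg: "x < x'" "b x * b x' < 0" using Cons.prems by auto
  then have "0 < (b x' - b x) * b x'" by (auto simp: zero_less_mult_iff mult_less_0_iff)
  from forward_difference_sign[OF neg(1) this] obtain w where w: "x \<le> w" "w < x'"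
    "0 < forward_difference b w * b x'" by blast
  show ?case
    using y w mult_neg_transfer[OF w(3) y(4)] mult_neg_transfer[OF w(3) neg(2)]
    by (intro exI[of _ w] exI[of _ "y # ys"]) auto
qed

text \<open>The decay on the left supplies one further point, where the difference has the sign of
  the first value.\<close>

lemma alternating_forward_difference:
  assumes "alternating b xs" "xs \<noteq> []" "\<forall>k\<in>set xs. b k \<noteq> 0"
    and top: "(b \<longlongrightarrow> 0) at_top" and bot: "(b \<longlongrightarrow> 0) at_bot"
  shows "\<exists>ys. length ys = Suc (length xs) \<and> alternating (forward_difference b) ys"
proof -
  obtain x xs' where xs: "xs = x # xs'" using assms(2) by (cases xs) auto
  obtain y ys where y: "length ys = length xs'" "alternating (forward_difference b) (y # ys)"
    "x \<le> y" "forward_difference b y * b x < 0"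
    using alternating_forward_difference_right[of b x xs'] assms xs by blast
  obtain w where w: "w < x" "0 < forward_difference b w * b x"
    using forward_difference_sign_at_bot[OF bot, of x] assms(3) xs by auto
  show ?thesis
    using y w mult_neg_transfer[OF w(2) y(4)] xs by (intro exI[of _ "w # y # ys"]) auto
qed

lemma forward_difference_funpow_tendsto_0:
  assumes "(b \<longlongrightarrow> 0) at_top" "(b \<longlongrightarrow> 0) at_bot"
  shows "((forward_difference ^^ n) b \<longlongrightarrow> 0) at_top \<and> ((forward_difference ^^ n) b \<longlongrightarrow> 0) at_bot"
proof (induction n)
  case 0
  then show ?case using assms by simp
next
  case (Suc n)
  have "\<forall>\<^sub>F k in at_top. Z \<le> k + 1" for Z :: int
    using eventually_ge_at_top[of Z] by (rule eventually_mono) auto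
  then have shift_top: "filterlim (\<lambda>k::int. k + 1) at_top at_top"
    unfolding filterlim_at_top by blast
  have top: "((\<lambda>k. c (k + 1)) \<longlongrightarrow> 0) at_top" if "(c \<longlongrightarrow> 0) at_top" for c :: "int \<Rightarrow> real"
    by (rule filterlim_compose[OF that shift_top])
  have "\<forall>\<^sub>F k in at_bot. k + 1 \<le> Z" for Z :: int
    using eventually_le_at_bot[of "Z - 1"] by (rule eventually_mono) auto
  then have shift_bot: "filterlim (\<lambda>k::int. k + 1) at_bot at_bot"
    unfolding filterlim_at_bot by blast
  have bot: "((\<lambda>k. c (k + 1)) \<longlongrightarrow> 0) at_bot" if "(c \<longlongrightarrow> 0) at_bot" for c :: "int \<Rightarrow> real"
    by (rule filterlim_compose[OF that shift_bot])
  let ?c = "(forward_difference ^^ n) b"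
  have "(forward_difference ^^ Suc n) b = (\<lambda>k. ?c (k + 1) - ?c k)"
    by (simp add: forward_difference_def fun_eq_iff)
  then show ?case
    using Suc tendsto_diff[OF top[of ?c], of ?c 0] tendsto_diff[OF bot[of ?c], of ?c 0] by simp
qed

lemma forward_difference_funpow_changes_sign:
  assumes "(b \<longlongrightarrow> 0) at_top" "(b \<longlongrightarrow> 0) at_bot" "b k \<noteq> 0"
  shows "changes_sign_at_least ((forward_difference ^^ n) b) n"
proof -
  \<comment> \<open>Nonvanishing is carried along because the initial list \<open>[k]\<close>
    alternates vacuously.\<close>
  have "\<exists>xs. length xs = Suc n \<and> alternating ((forward_difference ^^ n) b) xs \<and>
      (\<forall>k\<in>set xs. (forward_difference ^^ n) b k \<noteq> 0)"
  proof (induction n)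
    case 0
    then show ?case using assms(3) by (intro exI[of _ "[k]"]) auto
  next
    case (Suc n)
    then obtain xs where xs: "length xs = Suc n" "alternating ((forward_difference ^^ n) b) xs"
      "\<forall>k\<in>set xs. (forward_difference ^^ n) b k \<noteq> 0" by blast
    have "xs \<noteq> []" using xs(1) by auto
    with alternating_forward_difference[OF xs(2) _ xs(3)] xs(1)
      forward_difference_funpow_tendsto_0[OF assms(1,2), of n]
    obtain ys where ys: "length ys = Suc (Suc n)"
      "alternating ((forward_difference ^^ Suc n) b) ys" by auto
    then have "\<forall>k\<in>set ys. (forward_difference ^^ Suc n) b k \<noteq> 0"
      using alternating_nonzero[OF ys(2)] by simp
    then show ?case using ys by blast
  qed
  then show ?thesis unfolding changes_sign_at_least_iff by blast
qed

section \<open>Compactly supported functions\<close>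

lemma alternating_same_sign:
  assumes "alternating f xs" "\<And>x. x \<in> set xs \<Longrightarrow> 0 < f x * g x"
  shows "alternating g xs"
  using assms(1) unfolding alternating_def
proof (rule successively_mono)
  fix x y assume "x \<in> set xs" "y \<in> set xs" "x < y \<and> f x * f y < 0"
  then show "x < y \<and> g x * g y < 0"
    using assms(2)[of x] assms(2)[of y] by (auto simp: zero_less_mult_iff mult_less_0_iff)
qed

text \<open>Take \<open>z\<close> to be the first sign change. The factor \<open>x - z\<close>
  reverses signs to the left of \<open>z\<close> and keeps them to the right, which removes exactly
  this change.\<close>

lemma changes_sign_exactly_factor:
  fixes g :: "real \<Rightarrow> real"
  assumes ex: "changes_sign_exactly g (Suc m)" and cont: "continuous_on UNIV g"
    and supp: "\<And>x. x \<notin> {a..b} \<Longrightarrow> g x = 0"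
  shows "\<exists>z\<in>{a..b}. changes_sign_exactly (\<lambda>x. g x * (x - z)) m"
proof -
  have no: "\<not> alternating g xs" if "length xs = m + 3" for xs
    using ex that unfolding changes_sign_exactly_def changes_sign_at_least_iff by auto
  obtain xs where "length xs = Suc (Suc m)" "alternating g xs"
    using ex unfolding changes_sign_exactly_def changes_sign_at_least_iff by auto
  then obtain x0 x1 xs' where xs: "length xs' = m" "alternating g (x0 # x1 # xs')"
    by (auto simp: length_Suc_conv)
  have x01: "x0 < x1" "g x0 * g x1 < 0" using xs by auto
  then have nz: "g x0 \<noteq> 0" "g x1 \<noteq> 0" by auto
  \<comment> \<open>A point of opposite sign before \<open>x0\<close> would prolong the list to
    \<open>m + 3\<close> points.\<close>
  have before: "0 \<le> g x * g x0" if "x \<le> x0" for x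
  proof (rule ccontr)
    assume "\<not> 0 \<le> g x * g x0"
    moreover from this have "x \<noteq> x0" by (auto simp: mult_less_0_iff)
    ultimately have "alternating g (x # x0 # x1 # xs')" using xs that by auto
    then show False using no[of "x # x0 # x1 # xs'"] xs by simp
  qed
  define T where "T = {t. \<forall>x\<le>t. 0 \<le> g x * g x0}"
  define z where "z = Sup T"
  have "x0 \<in> T" using before by (auto simp: T_def)
  have Tlt: "t < x1" if "t \<in> T" for t
  proof (rule ccontr)
    assume "\<not> t < x1"
    then have "0 \<le> g x1 * g x0" using that by (auto simp: T_def)
    then show False using x01 by (simp add: mult.commute)
  qed
  then have bdd: "bdd_above T" by (meson bdd_aboveI less_imp_le)
  have "x0 \<le> z" unfolding z_def by (rule cSup_upper[OF \<open>x0 \<in> T\<close> bdd])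
  \<comment> \<open>Continuity extends the weak sign condition from the left of \<open>z\<close> to
    \<open>z\<close> itself.\<close>
  have "{..<z} \<subseteq> {x. 0 \<le> g x * g x0}"
    using less_cSup_iff[OF _ bdd] \<open>x0 \<in> T\<close> unfolding z_def T_def by fastforce
  moreover have "closed {x. 0 \<le> g x * g x0}"
    using cont by (intro closed_Collect_le continuous_intros)
  ultimately have "closure {..<z} \<subseteq> {x. 0 \<le> g x * g x0}" by (rule closure_minimal)
  then have below: "0 \<le> g x * g x0" if "x \<le> z" for x using that by (auto simp: subset_iff)
  have "z < x1"
    using below[of x1] x01 by (force simp: mult.commute)
  \<comment> \<open>As \<open>z\<close> is the supremum of \<open>T\<close>, the opposite sign
    occurs arbitrarily close to the right of \<open>z\<close>.\<close>
  have above: "\<exists>w. z < w \<and> w < y \<and> g w * g x0 < 0" if "z < y" for y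
  proof -
    have "(z + y) / 2 \<notin> T"
      using that cSup_upper[OF _ bdd, of "(z + y) / 2"] unfolding z_def[symmetric] by auto
    then obtain w where w: "w \<le> (z + y) / 2" "g w * g x0 < 0"
      by (auto simp: T_def not_le)
    then have "\<not> w \<le> z" using below[of w] by linarith
    then show ?thesis using w that by (intro exI[of _ w]) auto
  qed
  let ?h = "\<lambda>x. g x * (x - z)"
  have same: "0 < g x * ?h x" if "z < x" "g x \<noteq> 0" for x
    using that by (auto simp: zero_less_mult_iff mult_less_0_iff)
  have "x0 \<in> {a..b}" "x1 \<in> {a..b}" using supp nz by blast+
  then have "z \<in> {a..b}" using \<open>x0 \<le> z\<close> \<open>z < x1\<close> by auto
  moreover have "changes_sign_at_least ?h m"
  proof -
    have "alternating ?h (x1 # xs')"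
    proof (rule alternating_same_sign[OF alternating_ConsD[OF xs(2)]])
      fix x assume x: "x \<in> set (x1 # xs')"
      then have "g x \<noteq> 0" using alternating_nonzero[OF xs(2)] by auto
      moreover have "z < x"
        using x \<open>z < x1\<close> alternating_hd_less[OF alternating_ConsD[OF xs(2)], of x] by auto
      ultimately show "0 < g x * ?h x" using same by blast
    qed
    then show ?thesis unfolding changes_sign_at_least_iff using xs(1)
      by (intro exI[of _ "x1 # xs'"]) auto
  qed
  \<comment> \<open>From \<open>m + 2\<close> alternating points of \<open>?h\<close>, an
    alternating list of \<open>m + 3\<close> points of \<open>g\<close> is built.\<close>
  moreover have "\<not> changes_sign_at_least ?h (m + 1)"
  proof
    assume "changes_sign_at_least ?h (m + 1)"
    then obtain ys where "length ys = Suc (Suc m)" "alternating ?h ys"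
      unfolding changes_sign_at_least_iff by auto
    then obtain y0 y1 ys' where ys: "length ys' = m" "alternating ?h (y0 # y1 # ys')"
      by (auto simp: length_Suc_conv)
    have hnz: "?h y \<noteq> 0" if "y \<in> set (y0 # y1 # ys')" for y
      using alternating_nonzero[OF ys(2) _ that] by simp
    have y01: "y0 < y1" "?h y0 * ?h y1 < 0" using ys by auto
    have nz': "g y0 \<noteq> 0" "g y1 \<noteq> 0" "y0 \<noteq> z" "y1 \<noteq> z" using hnz[of y0] hnz[of y1] by auto
    \<comment> \<open>To the left of \<open>z\<close> the function \<open>?h\<close> never has the
      sign of \<open>g x0\<close>, so it cannot alternate there.\<close>
    have "z < y1"
    proof (rule ccontr)
      assume "\<not> z < y1"
      then have "y0 < z" "y1 < z" "0 < g y0 * g x0" "0 < g y1 * g x0"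
        using y01 nz' nz below[of y0] below[of y1] by (auto simp: order_less_le)
      then show False using y01 by (auto simp: zero_less_mult_iff mult_less_0_iff)
    qed
    have galt: "alternating g vs" if "alternating ?h vs" "set vs \<subseteq> set (y0 # y1 # ys')"
      "\<And>v. v \<in> set vs \<Longrightarrow> z < v" for vs
    proof (rule alternating_same_sign[OF that(1)])
      fix v assume "v \<in> set vs"
      then show "0 < ?h v * g v"
        using same[of v] hnz[of v] that(2,3) by (auto simp: mult.commute)
    qed
    have gt: "z < v" if "v \<in> set (y1 # ys')" for v
      using that \<open>z < y1\<close> alternating_hd_less[OF alternating_ConsD[OF ys(2)], of v] by auto
    show False
    \<comment> \<open>If \<open>y0 < z\<close>, then \<open>g y1\<close> has the sign of
      \<open>g x0\<close>, and \<open>y0\<close> is replaced by \<open>x0\<close> and a point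
      \<open>w\<close> of the other sign between \<open>z\<close> and \<open>y1\<close>. If
      \<open>z < y0\<close>, the list alternates for \<open>g\<close> already and a point is put in
      front of it.\<close>
    proof (cases "y0 < z")
      case True
      have g1: "alternating g (y1 # ys')"
        using galt[OF alternating_ConsD[OF ys(2)]] gt by auto
      have "0 < g y0 * g x0" using below[of y0] True nz nz' by (auto simp: order_less_le)
      then have "0 < g y1 * g x0"
        using y01(2) True \<open>z < y1\<close> by (auto simp: zero_less_mult_iff mult_less_0_iff)
      moreover obtain w where w: "z < w" "w < y1" "g w * g x0 < 0"
        using above[OF \<open>z < y1\<close>] by blast
      ultimately have "g x0 * g w < 0" "g w * g y1 < 0"
        by (auto simp: zero_less_mult_iff mult_less_0_iff)
      then have "alternating g (x0 # w # y1 # ys')"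
        using w \<open>x0 \<le> z\<close> g1 by auto
      then show False using no[of "x0 # w # y1 # ys'"] ys by simp
    next
      case False
      then have "z < y0" using nz' by auto
      have g0: "alternating g (y0 # y1 # ys')"
        using galt[OF ys(2)] gt \<open>z < y0\<close> by auto
      obtain u where u: "u < y0" "g u * g y0 < 0"
      proof (cases "g y0 * g x0 < 0")
        case True
        then show ?thesis using that[of x0] \<open>x0 \<le> z\<close> \<open>z < y0\<close> by (auto simp: mult.commute)
      next
        case False
        moreover obtain w where "z < w" "w < y0" "g w * g x0 < 0"
          using above[OF \<open>z < y0\<close>] by blast
        ultimately show ?thesis using that[of w] nz nz'
          by (auto simp: zero_less_mult_iff mult_less_0_iff not_less zero_le_mult_iff)
      qed
      then have "alternating g (u # y0 # y1 # ys')" using g0 by auto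
      then show False using no[of "u # y0 # y1 # ys'"] ys by simp
    qed
  qed
  ultimately show ?thesis unfolding changes_sign_exactly_def by blast
qed

text \<open>Each linear factor removes one sign change; without any left, the sign is constant and
  \<open>e\<close> records it.\<close>

lemma changes_sign_exactly_prod:
  fixes g :: "real \<Rightarrow> real"
  assumes "changes_sign_exactly g n" "continuous_on UNIV g" "\<And>x. x \<notin> {a..b} \<Longrightarrow> g x = 0"
  shows "\<exists>zs e. length zs = n \<and> set zs \<subseteq> {a..b} \<and> \<bar>e\<bar> = 1 \<and>
    (\<forall>x. 0 \<le> e * (g x * (\<Prod>z\<leftarrow>zs. x - z)))"
  using assms
proof (induction n arbitrary: g)
  case 0
  have no: "\<not> (x < y \<and> g x * g y < 0)" for x y
  proof
    assume "x < y \<and> g x * g y < 0"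
    then have "alternating g [x, y]" by simp
    then have "changes_sign_at_least g 1"
      unfolding changes_sign_at_least_iff by (intro exI[of _ "[x, y]"]) auto
    then show False using 0 by (simp add: changes_sign_exactly_def)
  qed
  have nneg: "0 \<le> g x * g y" for x y
    using no[of x y] no[of y x] by (cases x y rule: linorder_cases) (auto simp: mult.commute not_less)
  show ?case
  proof (cases "\<exists>x. g x < 0")
    case True
    then obtain x where "g x < 0" by blast
    then have "g y \<le> 0" for y using nneg[of x y] by (auto simp: zero_le_mult_iff)
    then show ?thesis by (intro exI[of _ "[]"] exI[of _ "-1"]) auto
  next
    case False
    then show ?thesis by (intro exI[of _ "[]"] exI[of _ "1"]) (auto simp: not_less)
  qed
next
  case (Suc n)
  obtain z where z: "z \<in> {a..b}" "changes_sign_exactly (\<lambda>x. g x * (x - z)) n"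
    using changes_sign_exactly_factor[OF Suc.prems] by blast
  have "continuous_on UNIV (\<lambda>x. g x * (x - z))"
    using Suc.prems(2) by (intro continuous_intros)
  with Suc.IH[OF z(2)] Suc.prems(3) obtain zs e where "length zs = n" "set zs \<subseteq> {a..b}" "\<bar>e\<bar> = 1"
    "\<forall>x. 0 \<le> e * (g x * (x - z) * (\<Prod>z\<leftarrow>zs. x - z))" by auto
  then show ?case using z(1)
    by (intro exI[of _ "z # zs"] exI[of _ e]) (auto simp: mult.assoc)
qed

section \<open>Derivatives of products of linear factors and integration by parts\<close>

text \<open>The Leibniz rule stops after two terms, as the second derivative of a linear factor
  vanishes.\<close>

lemma higher_pderiv_linear_mult:
  fixes q :: "real poly"
  shows "(pderiv ^^ Suc n) ([:- z, 1:] * q) =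
    [:- z, 1:] * (pderiv ^^ Suc n) q + smult (real (Suc n)) ((pderiv ^^ n) q)"
proof -
  have lin: "pderiv ([:- z, 1:] * p) = [:- z, 1:] * pderiv p + p" for p :: "real poly"
  proof -
    have "pderiv [:- z, 1:] = 1" by (simp add: pderiv_pCons)
    then show ?thesis by (simp only: pderiv_mult mult_1_right)
  qed
  show ?thesis
  proof (induction n)
    case 0
    then show ?case using lin[of q] by simp
  next
    case (Suc n)
    have "(pderiv ^^ Suc (Suc n)) ([:- z, 1:] * q) = pderiv ((pderiv ^^ Suc n) ([:- z, 1:] * q))"
      by simp
    also have "\<dots> = [:- z, 1:] * pderiv ((pderiv ^^ Suc n) q) + (pderiv ^^ Suc n) q
        + smult (real (Suc n)) ((pderiv ^^ Suc n) q)"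
      unfolding Suc.IH pderiv_add pderiv_smult lin by simp
    also have "\<dots> = [:- z, 1:] * (pderiv ^^ Suc (Suc n)) q
        + smult (real (Suc (Suc n))) ((pderiv ^^ Suc n) q)"
      by (simp only: of_nat_Suc[of "Suc n"] smult_add_left smult_1_left add.assoc funpow.simps o_apply)
    finally show ?case .
  qed
qed

lemma higher_pderiv_prod_linear:
  fixes zs :: "real list"
  shows "(pderiv ^^ length zs) (\<Prod>z\<leftarrow>zs. [:- z, 1:]) = [:fact (length zs):]"
proof (induction zs)
  case (Cons z zs)
  then show ?case
    by (simp only: list.map prod_list.Cons list.size higher_pderiv_linear_mult add_Suc_right add_0_right)
       (simp add: pderiv_pCons)
qed simp

text \<open>Only the three leading coefficients of the monic product survive: \<open>1\<close>,
  \<open>- s\<close> and the second elementary symmetric function of the roots, which is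
  \<open>(s\<^sup>2 - t) / 2\<close>.\<close>

lemma higher_pderiv_prod_linear_square:
  fixes zs :: "real list"
  defines "n \<equiv> length zs" and "s \<equiv> sum_list zs" and "t \<equiv> (\<Sum>z\<leftarrow>zs. z\<^sup>2)"
  shows "(pderiv ^^ n) ((\<Prod>z\<leftarrow>zs. [:- z, 1:]) * [:0, 0, 1:]) =
    [:fact n * (s\<^sup>2 - t) / 2, - (fact (n + 1) * s), fact (n + 2) / 2:]"
  unfolding assms
proof (induction zs)
  case (Cons z zs)
  then show ?case
    by (simp only: list.map prod_list.Cons list.size mult.assoc higher_pderiv_linear_mult add_Suc_right add_0_right)
       (simp add: pderiv_pCons power2_eq_square field_simps)
qed simp

text \<open>Integration by parts \<open>n\<close> times; all boundary terms vanish. Polynomials are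
  taken in \<open>x - c\<close> so that moments about \<open>c\<close> result.\<close>

lemma integral_poly_mult_derivative:
  fixes F :: "nat \<Rightarrow> real \<Rightarrow> real"
  assumes F: "\<And>j x. (F j has_real_derivative F (Suc j) x) (at x)"
    and bd: "\<And>j. F j a = 0" "\<And>j. F j b = 0" and "a \<le> b"
  shows "integral {a..b} (\<lambda>x. poly p (x - c) * F n x) =
    (-1) ^ n * integral {a..b} (\<lambda>x. poly ((pderiv ^^ n) p) (x - c) * F 0 x)"
proof (induction n arbitrary: p)
  case (Suc n)
  have cont: "continuous_on {a..b} (F j)" for j
    using F by (meson DERIV_isCont continuous_at_imp_continuous_on)
  have int: "(\<lambda>x. poly q (x - c) * F j x) integrable_on {a..b}" for q j
    by (intro integrable_continuous_real continuous_intros cont)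
  have "((\<lambda>x. poly (pderiv p) (x - c) * F n x + poly p (x - c) * F (Suc n) x) has_integral
      (poly p (b - c) * F n b - poly p (a - c) * F n a)) {a..b}"
  proof (rule fundamental_theorem_of_calculus[OF \<open>a \<le> b\<close>])
    fix x
    have "((\<lambda>x. poly p (x - c)) has_real_derivative poly (pderiv p) (x - c)) (at x)"
      by (rule DERIV_chain2[OF poly_DERIV, THEN DERIV_cong]) (auto intro!: derivative_eq_intros)
    from DERIV_mult[OF this F]
    show "((\<lambda>x. poly p (x - c) * F n x) has_vector_derivative
        poly (pderiv p) (x - c) * F n x + poly p (x - c) * F (Suc n) x) (at x within {a..b})"
      unfolding has_real_derivative_iff_has_vector_derivative[symmetric]
      by (auto intro: has_field_derivative_at_within simp: algebra_simps)
  qed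
  then have "integral {a..b} (\<lambda>x. poly (pderiv p) (x - c) * F n x)
      + integral {a..b} (\<lambda>x. poly p (x - c) * F (Suc n) x) = 0"
    using bd by (simp add: integral_add[OF int int, symmetric] integral_unique)
  then show ?case using Suc.IH[of "pderiv p"] by (simp add: funpow_Suc_right del: funpow.simps)
qed simp

lemma no_compactly_supported_bell_shape:
  fixes F :: "nat \<Rightarrow> real \<Rightarrow> real"
  assumes F: "\<And>j x. (F j has_real_derivative F (Suc j) x) (at x)"
    and nonneg: "\<And>x. 0 \<le> F 0 x" and sign: "\<And>n. changes_sign_exactly (F n) n"
    and supp: "\<And>j x. x \<notin> {a<..<b} \<Longrightarrow> F j x = 0"
  shows "F 0 x = 0"
proof (rule ccontr)
  assume x: "F 0 x \<noteq> 0"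
  then have xab: "a < x" "x < b" using supp by force+
  then have ab: "a < b" by simp
  have cont: "continuous_on A (F j)" for A j
    using F by (meson DERIV_isCont continuous_at_imp_continuous_on)
  have int: "(\<lambda>x. g x * F j x) integrable_on {a..b}" if "continuous_on {a..b} g" for g j
    by (intro integrable_continuous_real continuous_intros cont that)
  have supp': "F j y = 0" if "y \<notin> {a..b}" for j y using supp[of y j] that by auto
  let ?I = "\<lambda>g. integral {a..b} (\<lambda>x. g x * F 0 x)"
  define M where "M = integral {a..b} (F 0)"
  have Fint: "F j integrable_on {a..b}" for j
    by (intro integrable_continuous_real cont)
  have "M \<ge> 0" unfolding M_def by (rule integral_nonneg[OF Fint]) (use nonneg in auto)
  moreover have "M \<noteq> 0"
    unfolding M_def using integral_eq_0_iff[OF cont ab, of 0] nonneg x xab by force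
  ultimately have M: "M > 0" by simp
  \<comment> \<open>At the barycentre the first moment is zero, which later kills the linear
    coefficient \<open>B\<close>.\<close>
  define c where "c = ?I (\<lambda>x. x) / M"
  define V where "V = ?I (\<lambda>x. (x - c)\<^sup>2)"
  have M1: "?I (\<lambda>x. x - c) = 0"
  proof -
    have "?I (\<lambda>x. x - c) = ?I (\<lambda>x. x) - ?I (\<lambda>x. c)"
      unfolding left_diff_distrib by (intro integral_diff int continuous_intros)
    then show ?thesis using M by (simp add: c_def M_def)
  qed
  have const: "?I (\<lambda>x. d) = d * M" for d by (simp add: M_def)
  have "?I (\<lambda>x. a) \<le> ?I (\<lambda>x. x)" "?I (\<lambda>x. x) \<le> ?I (\<lambda>x. b)"
    by (intro integral_le int continuous_intros mult_right_mono nonneg; simp)+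
  then have c: "a \<le> c" "c \<le> b"
    unfolding const using M by (simp_all add: c_def field_simps)
  have "V \<ge> 0"
    unfolding V_def using nonneg by (intro integral_nonneg int continuous_intros) auto
  let ?R = "b - a"
  have dist: "(y - c)\<^sup>2 \<le> ?R\<^sup>2" if "y \<in> {a..b}" for y
    by (rule power2_le_iff_abs_le[THEN iffD2]) (use that c ab in auto)
  have bound: "real (n + 1) * V \<le> ?R\<^sup>2 * M" for n
  proof -
    obtain zs e where zs: "length zs = n" "set zs \<subseteq> {a..b}" and e: "\<bar>e\<bar> = 1"
      and pos: "\<And>x. 0 \<le> e * (F n x * (\<Prod>z\<leftarrow>zs. x - z))"
      using changes_sign_exactly_prod[OF sign cont supp'] by blast
    \<comment> \<open>The roots are shifted to the variable \<open>x - c\<close>.\<close>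
    define ws where "ws = map (\<lambda>z. z - c) zs"
    define p where "p = (\<Prod>w\<leftarrow>ws. [:- w, 1:])"
    have lws: "length ws = n" using zs by (simp add: ws_def)
    have p: "poly p (x - c) = (\<Prod>z\<leftarrow>zs. x - z)" for x
      unfolding p_def ws_def by (induction zs) (auto simp: algebra_simps)
    have pos': "0 \<le> e * (poly p (x - c) * F n x)" for x
      using pos[of x] unfolding p by (simp add: mult.commute)
    let ?p2 = "p * [:0, 0, 1:]"
    let ?J = "\<lambda>q. integral {a..b} (\<lambda>x. poly q (x - c) * F n x)"
    define s where "s = sum_list ws"
    define t where "t = (\<Sum>w\<leftarrow>ws. w\<^sup>2)"
    have bd: "F j a = 0" "F j b = 0" for j using supp by auto
    have parts: "?J q = (-1) ^ n * ?I (\<lambda>x. poly ((pderiv ^^ n) q) (x - c))" for q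
      by (rule integral_poly_mult_derivative[where F = F and a = a and b = b, OF F bd less_imp_le[OF ab]])
    have J1: "?J p = (-1) ^ n * (fact n * M)"
      unfolding parts[of p] using higher_pderiv_prod_linear[of ws] lws
      by (simp add: p_def[symmetric] M_def)
    define A where "A = fact n * (s\<^sup>2 - t) / 2"
    define B where "B = - (fact (n + 1) * s)"
    define C where "C = (fact (n + 2) / 2 :: real)"
    have p2: "(pderiv ^^ n) ?p2 = [:A, B, C:]"
      using higher_pderiv_prod_linear_square[of ws] lws
      unfolding A_def B_def C_def p_def s_def t_def by simp
    have "poly [:A, B, C:] (x - c) * F 0 x =
        A * F 0 x + (B * ((x - c) * F 0 x) + C * ((x - c)\<^sup>2 * F 0 x))" for x
      by (simp add: algebra_simps power2_eq_square)
    then have "?J ?p2 = (-1) ^ n *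
        integral {a..b} (\<lambda>x. A * F 0 x + (B * ((x - c) * F 0 x) + C * ((x - c)\<^sup>2 * F 0 x)))"
      unfolding parts[of ?p2] p2 by presburger
    also have "integral {a..b} (\<lambda>x. A * F 0 x + (B * ((x - c) * F 0 x) + C * ((x - c)\<^sup>2 * F 0 x)))
        = A * M + (B * ?I (\<lambda>x. x - c) + C * V)"
    proof -
      have "(\<lambda>x. B * ((x - c) * F 0 x)) integrable_on {a..b}"
        "(\<lambda>x. C * ((x - c)\<^sup>2 * F 0 x)) integrable_on {a..b}"
        "(\<lambda>x. A * F 0 x) integrable_on {a..b}"
        by (intro integrable_continuous_real continuous_intros cont)+
      then show ?thesis unfolding M_def V_def by (simp add: integral_add integrable_add)
    qed
    finally have J2: "?J ?p2 = (-1) ^ n * (A * M + C * V)" using M1 by simp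
    have intJ: "(\<lambda>x. e * (poly q (x - c) * F n x)) integrable_on {a..b}" for q
      by (intro integrable_continuous_real continuous_intros cont)
    have "0 \<le> integral {a..b} (\<lambda>x. e * (poly p (x - c) * F n x))"
      by (rule integral_nonneg[OF intJ]) (rule pos')
    then have "0 \<le> e * (-1) ^ n * (fact n * M)" using J1 by simp
    then have "0 \<le> e * (-1) ^ n"
      using M mult_neg_pos[of "e * (-1) ^ n" "fact n * M"] by fastforce
    \<comment> \<open>A number of absolute value 1 that is not negative.\<close>
    then have sgn: "e * (-1) ^ n = 1"
      using e by (cases "even n") (auto simp: abs_if split: if_splits)
    have "integral {a..b} (\<lambda>x. e * (poly ?p2 (x - c) * F n x))
        \<le> integral {a..b} (\<lambda>x. ?R\<^sup>2 * (e * (poly p (x - c) * F n x)))"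
    proof (rule integral_le[OF intJ])
      show "(\<lambda>x. ?R\<^sup>2 * (e * (poly p (x - c) * F n x))) integrable_on {a..b}"
        by (intro integrable_continuous_real continuous_intros cont)
      fix y assume "y \<in> {a..b}"
      from mult_right_mono[OF dist[OF this] pos'[of y]]
      show "e * (poly ?p2 (y - c) * F n y) \<le> ?R\<^sup>2 * (e * (poly p (y - c) * F n y))"
        by (simp add: power2_eq_square algebra_simps)
    qed
    then have "e * ?J ?p2 \<le> ?R\<^sup>2 * (e * ?J p)" by simp
    then have "(e * (-1) ^ n) * (A * M + C * V) \<le> ?R\<^sup>2 * ((e * (-1) ^ n) * (fact n * M))"
      unfolding J1 J2 by (simp add: mult.assoc)
    then have "A * M + C * V \<le> ?R\<^sup>2 * (fact n * M)" unfolding sgn by simp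
    also have "A * M + C * V = fact n * ((s\<^sup>2 - t) * M + (n + 1) * (n + 2) * V) / 2"
      by (simp add: A_def C_def field_simps)
    finally have "fact n * ((s\<^sup>2 - t) * M + (n + 1) * (n + 2) * V) \<le> fact n * (2 * ?R\<^sup>2 * M)"
      by (simp add: mult.commute mult.left_commute)
    then have "(s\<^sup>2 - t) * M + (n + 1) * (n + 2) * V \<le> 2 * ?R\<^sup>2 * M"
      by (rule mult_left_le_imp_le) simp
    \<comment> \<open>Roots and \<open>c\<close> lie in the same interval. With
      \<open>s\<^sup>2 \<ge> 0\<close> this costs at most \<open>n * ?R\<^sup>2 * M\<close>, for a
      total of \<open>(n + 2) * ?R\<^sup>2 * M\<close> on the right, and \<open>n + 2\<close>
      cancels.\<close>
    moreover have "t \<le> n * ?R\<^sup>2"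
    proof -
      have "set ys \<subseteq> {a..b} \<Longrightarrow> (\<Sum>y\<leftarrow>ys. (y - c)\<^sup>2) \<le> length ys * ?R\<^sup>2" for ys
        by (induction ys) (use dist in \<open>auto simp: algebra_simps intro!: add_mono\<close>)
      from this[OF zs(2)] show ?thesis by (simp add: t_def ws_def comp_def zs(1))
    qed
    then have "(0 - n * ?R\<^sup>2) * M \<le> (s\<^sup>2 - t) * M"
      using M by (intro mult_right_mono diff_mono) auto
    ultimately have "(n + 2) * (real (n + 1) * V) \<le> (n + 2) * (?R\<^sup>2 * M)"
      by (simp add: algebra_simps)
    then show ?thesis by (rule mult_left_le_imp_le) simp
  qed
  have "V \<le> 0"
  proof (rule ccontr)
    assume "\<not> V \<le> 0"
    then obtain n where "?R\<^sup>2 * M < real n * V" using ex_less_of_nat_mult[of V] by auto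
    then show False using bound[of n] \<open>\<not> V \<le> 0\<close> by (simp add: algebra_simps)
  qed
  then have "V = 0" using \<open>V \<ge> 0\<close> by simp
  moreover have "continuous_on {a..b} (\<lambda>x. (x - c)\<^sup>2 * F 0 x)"
    by (intro continuous_intros cont)
  ultimately have "\<forall>y\<in>{a..b}. (y - c)\<^sup>2 * F 0 y = 0"
    using integral_eq_0_iff[of a b "\<lambda>x. (x - c)\<^sup>2 * F 0 x"] nonneg ab by (simp add: V_def)
  \<comment> \<open>The weight vanishes at \<open>c\<close>, so the value there has to come from
    continuity.\<close>
  then have zero: "F 0 y = 0" if "y \<noteq> c" for y
    using that supp[of y 0] by (cases "y \<in> {a..b}") auto
  have "(F 0 \<longlongrightarrow> F 0 c) (at c)"
    using DERIV_isCont[OF F] by (simp add: isCont_def)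
  moreover have "(F 0 \<longlongrightarrow> 0) (at c)"
    by (rule tendsto_eventually) (auto simp: eventually_at_filter zero)
  ultimately have "F 0 c = 0" by (rule LIM_unique)
  then show False using zero x by metis
qed

section \<open>Bell-shaped functions restricted to the integers\<close>

text \<open>Otherwise the single sign change of \<open>f'\<close> leaves room for one bump only,
  between two neighbouring integers, and \<open>f\<close> would have compact support.\<close>

lemma bell_shaped_function_nonzero_at_int:
  assumes "bell_shaped_function f"
  shows "\<exists>k::int. f (of_int k) \<noteq> 0"
proof (rule ccontr)
  assume "\<nexists>k::int. f (of_int k) \<noteq> 0"
  then have zero: "f (of_int k) = 0" for k :: int by auto
  define F where "F n = (deriv ^^ n) f" for n
  have F0: "F 0 = f" by (simp add: F_def)
  have F: "(F j has_real_derivative F (Suc j) x) (at x)" for j x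
    using assms unfolding bell_shaped_function_def smooth_def F_def
    by (simp add: DERIV_deriv_iff_real_differentiable)
  have nonneg: "0 \<le> F 0 x" for x
    using assms unfolding bell_shaped_function_def F_def by simp
  have sign: "changes_sign_exactly (F n) n" for n
    using assms unfolding bell_shaped_function_def F_def by simp
  have mvt: "\<exists>z. u < z \<and> z < v \<and> 0 < F 1 z * (F 0 v - F 0 u)"
    if uv: "u < v" "F 0 u \<noteq> F 0 v" for u v
  proof -
    obtain z where z: "u < z" "z < v" "F 0 v - F 0 u = (v - u) * F 1 z"
      using MVT2[OF uv(1), of "F 0" "F 1"] F[of 0] by auto
    then have "F 1 z \<noteq> 0" using uv by auto
    then show ?thesis using z uv
      by (intro exI[of _ z]) (auto simp: mult.left_commute zero_less_mult_iff)
  qed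
  \<comment> \<open>The zero function meets the sign condition for \<open>n = 0\<close> but not for
    \<open>n = 1\<close>.\<close>
  obtain x where x: "F 0 x \<noteq> 0"
  proof (rule ccontr)
    assume "\<not> thesis"
    then have "F 0 x = 0" for x using that by blast
    then have "F 0 = (\<lambda>_. 0)" by auto
    then have "F 1 = (\<lambda>_. 0)" by (simp add: F_def)
    then show False
      using sign[of 1] unfolding changes_sign_exactly_def changes_sign_at_least_def by auto
  qed
  have x_pos: "0 < F 0 x" using x nonneg[of x] by simp
  \<comment> \<open>Two bumps separated by a zero would give \<open>f'\<close> the sign pattern \<open>+ - +\<close>.\<close>
  have one_bump: "False"
    if uvwy: "u < v" "v < w" "w < y" "F 0 u = 0" "0 < F 0 v" "F 0 w = 0" "0 < F 0 y"
    for u v w y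
  proof -
    obtain z1 where z1: "z1 < v" "0 < F 1 z1 * (F 0 v - F 0 u)" using mvt[of u v] uvwy by auto
    obtain z2 where z2: "v < z2" "z2 < w" "0 < F 1 z2 * (F 0 w - F 0 v)" using mvt[of v w] uvwy by auto
    obtain z3 where z3: "w < z3" "0 < F 1 z3 * (F 0 y - F 0 w)" using mvt[of w y] uvwy by auto
    have "0 < F 1 z1" "F 1 z2 < 0" "0 < F 1 z3"
      using z1 z2 z3 uvwy by (auto simp: zero_less_mult_iff mult_less_0_iff)
    then have "alternating (F 1) [z1, z2, z3]" using z1 z2 z3 by (auto simp: mult_less_0_iff)
    then have "changes_sign_at_least (F 1) 2"
      unfolding changes_sign_at_least_iff by (intro exI[of _ "[z1, z2, z3]"]) auto
    then show False using sign[of 1] by (simp add: changes_sign_exactly_def numeral_2_eq_2)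
  qed
  define k where "k = \<lfloor>x\<rfloor>"
  have "x \<noteq> of_int k" using x zero F0 by metis
  then have k: "of_int k < x" "x < of_int k + 1"
    unfolding k_def by linarith+
  have k0: "F 0 (of_int k) = 0" "F 0 (of_int k + 1) = 0"
    using zero[of k] zero[of "k + 1"] by (auto simp: F0)
  have supp: "F j y = 0" if "y < of_int k \<or> of_int k + 1 < y" for j y
    using that
  proof (induction j arbitrary: y)
    case 0
    have "\<not> 0 < F 0 y"
    proof
      assume y: "0 < F 0 y"
      from 0 show False
      proof
        assume "y < of_int k"
        \<comment> \<open>A point with \<open>f y > 0\<close> is no integer, so the integer below it
          is a zero of \<open>f\<close> strictly to the left.\<close>
        moreover have "of_int (\<lfloor>y\<rfloor>) < y"
          using y zero[of "\<lfloor>y\<rfloor>"] F0 of_int_floor_le[of y] by (metis less_irrefl order_less_le)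
        ultimately show False
          using one_bump[of "of_int \<lfloor>y\<rfloor>" y "of_int k" x] y x_pos k k0 zero F0 by simp
      next
        assume "of_int k + 1 < y"
        then show False using one_bump[of "of_int k" x "of_int k + 1" y] y x_pos k k0 by simp
      qed
    qed
    then show ?case using nonneg[of y] by simp
  next
    case (Suc j)
    \<comment> \<open>Derivatives are local: a function that vanishes on an open set has zero
      derivative there.\<close>
    have "open {y. y < real_of_int k \<or> real_of_int k + 1 < y}"
      by (intro open_Collect_disj open_Collect_less continuous_intros)
    then have "(F j has_real_derivative 0) (at y)"
      using has_field_derivative_transform_within_open[of "\<lambda>_. 0" 0 y
        "{y. y < real_of_int k \<or> real_of_int k + 1 < y}" "F j"] Suc by auto
    then show ?case using F DERIV_unique by blast
  qed
  \<comment> \<open>The interval is enlarged by 1 on both sides, since \<open>supp\<close> says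
    nothing about the endpoints \<open>k\<close> and \<open>k + 1\<close>.\<close>
  have "F 0 x = 0"
    by (rule no_compactly_supported_bell_shape[OF F nonneg sign, of "of_int k - 1" "of_int k + 2"])
       (rule supp, auto)
  then show False using x by simp
qed

theorem theorem1p10:
  fixes f :: "real \<Rightarrow> real"
  assumes "bell_shaped_function f"
  shows "bell_shaped_sequence (\<lambda>k::int. f (real_of_int k))"
proof -
  let ?a = "\<lambda>k::int. f (real_of_int k)"
  define F where "F n = (deriv ^^ n) f" for n
  have F: "(F j has_real_derivative F (Suc j) x) (at x)" for j x
    using assms unfolding bell_shaped_function_def smooth_def F_def
    by (simp add: DERIV_deriv_iff_real_differentiable)
  have lim: "(f \<longlongrightarrow> 0) at_bot" "(f \<longlongrightarrow> 0) at_top"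
    using assms unfolding bell_shaped_function_def by auto
  have "\<forall>\<^sub>F k in at_bot. real_of_int k \<le> Z" for Z
    using eventually_le_at_bot[of "\<lfloor>Z\<rfloor>"] by (rule eventually_mono) linarith
  then have "filterlim real_of_int at_bot at_bot"
    unfolding filterlim_at_bot by blast
  then have bot: "(?a \<longlongrightarrow> 0) at_bot"
    by (rule filterlim_compose[OF lim(1)])
  have top: "(?a \<longlongrightarrow> 0) at_top"
    by (rule filterlim_compose[OF lim(2) filterlim_real_of_int_at_top])
  obtain k :: int where "?a k \<noteq> 0"
    using bell_shaped_function_nonzero_at_int[OF assms] by blast
  \<comment> \<open>One nonzero integer value suffices to start the Rolle induction; the differences
    of a zero sequence would never change sign.\<close>
  then have lower: "changes_sign_at_least ((forward_difference ^^ n) ?a) n" for n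
    by (rule forward_difference_funpow_changes_sign[OF top bot])
  have upper: "\<not> changes_sign_at_least ((forward_difference ^^ n) ?a) (n + 1)" for n
  proof
    assume "changes_sign_at_least ((forward_difference ^^ n) ?a) (n + 1)"
    then have "changes_sign_at_least (F n) (n + 1)"
      using changes_sign_at_least_derivative[of F n "n + 1"] F by (simp add: F_def)
    then show False
      using assms unfolding bell_shaped_function_def changes_sign_exactly_def F_def by blast
  qed
  show ?thesis
    using assms bot top lower upper
    unfolding bell_shaped_sequence_def changes_sign_exactly_def bell_shaped_function_def by simp
qed

end
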